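(* Let $m \ge 1$ and $0 \le s \le m$ be integers and let $0<\alpha<1$. Let $p_1,\dots,p_m \in (0,1)$ be $p$-values such that the last $m-s$ of them, $p_{s+1},\dots,p_m$, are null, i.e. independent and uniformly distributed on $[0,1]$, while $p_1,\dots,p_s$ are arbitrary fixed numbers in $(0,1)$. For $1\le i\le m$ define $$\tilde{Y}_i = -\log(p_i), \qquad \tilde{Z}_i = \sum_{j=i}^m \frac{\tilde{Y}_j}{j}, \qquad \tilde{q}_i = e^{-\tilde{Z}_i},$$ and let $$\hat{k}_S = \max\left\{k \in \{1,\dots,m\} : \tilde{q}_k \le \frac{\alpha k}{m}\right\},$$ with the convention $\max(\emptyset)=0$. Then $$\mathbb{P}\left[\hat{k}_S > s\right] \le \alpha.$$
   Context: There are ordered hypotheses $H_1,\dots,H_m$ with $p$-values $p_1,\dots,p_m$. The procedure rejecting $H_1,\dots,H_{\hat k_S}$ is called StrongStop; the conclusion says that it controls the family-wise error rate (the probability of making at least one false rejection) at level $\alpha$. The analysis is conditional on the non-null $p$-values, i.e. they are treated as deterministic constants. *)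

theory Defs
  imports "HOL-Probability.Probability"
begin

text \<open>
  The definitions below take one realisation \<open>p\<close> of the vector of p-values, indexed by
  \<open>{1..m}\<close>; the value of \<open>p\<close> outside this range is irrelevant.
\<close>

definition Y_tilde :: "(nat \<Rightarrow> real) \<Rightarrow> nat \<Rightarrow> real" where
  "Y_tilde p i = - ln (p i)"

definition Z_tilde :: "nat \<Rightarrow> (nat \<Rightarrow> real) \<Rightarrow> nat \<Rightarrow> real" where
  "Z_tilde m p i = (\<Sum>j = i..m. Y_tilde p j / real j)"

definition q_tilde :: "nat \<Rightarrow> (nat \<Rightarrow> real) \<Rightarrow> nat \<Rightarrow> real" where
  "q_tilde m p i = exp (- Z_tilde m p i)"

definition strong_stop_set :: "nat \<Rightarrow> real \<Rightarrow> (nat \<Rightarrow> real) \<Rightarrow> nat set" where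
  "strong_stop_set m \<alpha> p = {k \<in> {1..m}. q_tilde m p k \<le> \<alpha> * real k / real m}"

text \<open>The case distinction is needed because \<^term>\<open>Max {}\<close> is unspecified.\<close>

definition k_hat_S :: "nat \<Rightarrow> real \<Rightarrow> (nat \<Rightarrow> real) \<Rightarrow> nat" where
  "k_hat_S m \<alpha> p =
     (if strong_stop_set m \<alpha> p = {} then 0 else Max (strong_stop_set m \<alpha> p))"

end

theory Submission imports Defs begin

text \<open>
  The event only involves the products \<open>\<Prod>j=k..m. p j powr (1 / j)\<close> with \<open>k > s\<close>. Let \<open>b = \<alpha> / m\<close> and let
  \<open>f k x\<close> be the probability that some \<open>j \<in> {s<..k}\<close> satisfies
  \<open>x * (\<Prod>i=j..k. p i powr (1 / i)) \<le> b * j\<close>. Then \<open>f k x \<le> b * k / x\<close> by induction on \<open>k\<close>: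
  conditioning on \<open>u = p n\<close> with \<open>n = k + 1\<close> and writing \<open>t = b * n / x\<close> (wlog \<open>t \<le> 1\<close>), the crossing at \<open>j = n\<close>
  has probability \<open>t ^ n\<close>, and for \<open>u > t ^ n\<close> the induction hypothesis bounds the remaining
  probability by \<open>b * k / (x * u powr (1 / n))\<close>, whose integral over \<open>{t ^ n..1}\<close> is exactly
  \<open>t - t ^ n\<close>. The case \<open>k = m\<close>, \<open>x = 1\<close> is the theorem.
\<close>

text \<open>The factor \<open>x\<close> collects the coordinates above \<open>k\<close> that have
  already been conditioned on. Writing the product as \<open>exp\<close> of a sum of logarithms
  matches \<open>q_tilde\<close> without any positivity condition on \<open>w\<close>.\<close>

definition crosses :: "nat \<Rightarrow> real \<Rightarrow> nat \<Rightarrow> real \<Rightarrow> (nat \<Rightarrow> real) \<Rightarrow> bool" where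
  "crosses s b k x w \<longleftrightarrow> (\<exists>j\<in>{s<..k}. x * exp (\<Sum>i=j..k. ln (w i) / real i) \<le> b * real j)"

lemma measurable_crosses [measurable]:
  assumes [measurable_cong]: "\<And>i. i \<in> {s<..k} \<Longrightarrow> sets (N i) = sets borel"
  shows "Measurable.pred (PiM {s<..k} N) (crosses s b k x)"
proof -
  have "Measurable.pred (PiM {s<..k} N) (\<lambda>w. x * exp (\<Sum>i=j..k. ln (w i) / real i) \<le> b * real j)"
    if j: "j \<in> {s<..k}" for j
  proof -
    have "(\<lambda>w. ln (w i) / real i) \<in> borel_measurable (PiM {s<..k} N)" if "i \<in> {j..k}" for i
    proof -
      have i: "i \<in> {s<..k}" using that j by auto
      then have "(\<lambda>w. w i) \<in> measurable (PiM {s<..k} N) (N i)"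
        by (rule measurable_component_singleton)
      then have [measurable]: "(\<lambda>w. w i) \<in> borel_measurable (PiM {s<..k} N)"
        by (simp add: assms[OF i] cong: measurable_cong_sets)
      show ?thesis by measurable
    qed
    then have [measurable]: "(\<lambda>w. \<Sum>i=j..k. ln (w i) / real i) \<in> borel_measurable (PiM {s<..k} N)"
      by (rule borel_measurable_sum)
    show ?thesis by measurable
  qed
  then show ?thesis
    unfolding crosses_def[abs_def] by (intro pred_intros_finite) auto
qed

text \<open>Each tail product up to \<open>Suc k\<close> contains the factor of index
  \<open>Suc k\<close>, so this factor can be absorbed into \<open>x\<close>.\<close>

lemma crosses_Suc:
  assumes "s \<le> k"
  shows "crosses s b (Suc k) x (w(Suc k := u)) \<longleftrightarrow>
    x * exp (ln u / real (Suc k)) \<le> b * real (Suc k) \<or> crosses s b k (x * exp (ln u / real (Suc k))) w"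
proof -
  have *: "x * exp (\<Sum>i=j..Suc k. ln ((w(Suc k := u)) i) / real i) =
      x * exp (ln u / real (Suc k)) * exp (\<Sum>i=j..k. ln (w i) / real i)" if "j \<le> Suc k" for j
  proof -
    have "(\<Sum>i=j..Suc k. ln ((w(Suc k := u)) i) / real i) =
        (\<Sum>i=j..k. ln ((w(Suc k := u)) i) / real i) + ln u / real (Suc k)"
      using that by (simp add: sum.cl_ivl_Suc)
    also have "(\<Sum>i=j..k. ln ((w(Suc k := u)) i) / real i) = (\<Sum>i=j..k. ln (w i) / real i)"
      by (intro sum.cong) auto
    finally show ?thesis by (simp only: exp_add mult_ac)
  qed
  \<comment> \<open>For \<open>j = Suc k\<close> the sum over \<open>{j..k}\<close> is empty and its
    \<open>exp\<close> is 1, which yields the first disjunct.\<close>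
  have "crosses s b (Suc k) x (w(Suc k := u)) \<longleftrightarrow> (\<exists>j\<in>insert (Suc k) {s<..k}.
      x * exp (ln u / real (Suc k)) * exp (\<Sum>i=j..k. ln (w i) / real i) \<le> b * real j)"
    unfolding crosses_def using assms by (intro bex_cong) (auto simp only: * greaterThanAtMost_iff)
  then show ?thesis
    by (simp only: bex_simps crosses_def) simp
qed

lemma prob_space_uniform01: "prob_space (uniform_measure lborel {0..1::real})"
  by (rule prob_space_uniform_measure) auto

text \<open>The antiderivative \<open>t * u powr (1 - 1 / n)\<close> of the second summand is
  \<open>t\<close> at 1 and \<open>t ^ n\<close> at the lower end, so it contributes
  \<open>t - t ^ n\<close>. The first summand restores the missing \<open>t ^ n\<close>.\<close>

lemma nn_integral_crossing_bound:
  fixes t :: real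
  assumes "0 < t" "t \<le> 1" "0 < n"
  shows "(\<integral>\<^sup>+u. indicator {0..t ^ n} u +
      ennreal (t * (1 - 1 / real n) * u powr (- 1 / real n)) * indicator {t ^ n..1} u \<partial>lborel) = ennreal t"
proof -
  have n: "1 / real n \<le> 1" using assms by simp
  have tn: "0 < t ^ n" "t ^ n \<le> 1" using assms by (auto simp: power_le_one)
  have "(\<integral>\<^sup>+u. ennreal (t * (1 - 1 / real n) * u powr (- 1 / real n)) * indicator {t ^ n..1} u \<partial>lborel)
      = ennreal (t * 1 powr (1 - 1 / real n) - t * (t ^ n) powr (1 - 1 / real n))"
  proof (rule nn_integral_FTC_Icc)
    fix u assume "u \<in> {t ^ n..1}"
    then have "0 < u" using tn by auto
    then show "((\<lambda>u. t * u powr (1 - 1 / real n)) has_real_derivative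
        t * (1 - 1 / real n) * u powr (- 1 / real n)) (at u)"
      by (auto intro!: derivative_eq_intros)
    show "0 \<le> t * (1 - 1 / real n) * u powr (- 1 / real n)"
      using n assms by simp
  qed (use tn in auto)
  also have "t * (t ^ n) powr (1 - 1 / real n) = t ^ n"
  proof -
    have "t * (t ^ n) powr (1 - 1 / real n) = t * t powr (real n - 1)"
      using assms by (simp add: powr_realpow[symmetric] powr_powr right_diff_distrib)
    also have "\<dots> = t ^ n"
      using assms by (simp add: powr_mult_base powr_realpow)
    finally show ?thesis .
  qed
  finally have *: "(\<integral>\<^sup>+u. ennreal (t * (1 - 1 / real n) * u powr (- 1 / real n)) * indicator {t ^ n..1} u \<partial>lborel)
      = ennreal (t - t ^ n)" by simp
  \<comment> \<open>This keeps \<open>t - t ^ n\<close> nonnegative, so that \<open>ennreal\<close>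
    does not truncate it.\<close>
  have "t ^ n \<le> t" using power_decreasing[of 1 n t] assms by simp
  moreover have "(\<integral>\<^sup>+u. indicator {0..t ^ n} u \<partial>lborel) = ennreal (t ^ n)"
    using tn by simp
  ultimately show ?thesis
    using tn by (subst nn_integral_add) (simp_all only: *, auto simp: ennreal_plus[symmetric] simp del: ennreal_plus)
qed

text \<open>The induction needs \<open>x\<close> arbitrary: fixing the top coordinate at
  \<open>u\<close> leaves the same problem with \<open>x\<close> scaled by
  \<open>u powr (1 / n)\<close>. It starts at \<open>k = s\<close>, where no index is available for
  a crossing.\<close>

lemma prob_crosses_le:
  fixes b x :: real
  defines "U \<equiv> uniform_measure lborel {0..1::real}"
  assumes "s \<le> k" "0 < b" "0 < x"
  shows "emeasure (PiM {s<..k} (\<lambda>_. U)) {w \<in> space (PiM {s<..k} (\<lambda>_. U)). crosses s b k x w}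
    \<le> ennreal (b * real k / x)"
  using assms(2,4)
proof (induction k arbitrary: x rule: nat_induct_at_least)
  case base
  then show ?case by (simp add: crosses_def)
next
  case (Suc k)
  interpret U: prob_space U
    unfolding U_def by (rule prob_space_uniform01)
  interpret P: product_prob_space "\<lambda>_::nat. U" UNIV
    by unfold_locales
  have sets_U [measurable_cong]: "sets U = sets borel" by (simp add: U_def)
  let ?P = "\<lambda>k. PiM {s<..k} (\<lambda>_. U)"
  let ?E = "\<lambda>k x. {w \<in> space (?P k). crosses s b k x w}"
  interpret Pk: prob_space "?P k"
    by (rule prob_space_PiM) (rule U.prob_space_axioms)
  interpret Pk': prob_space "?P (Suc k)"
    by (rule prob_space_PiM) (rule U.prob_space_axioms)
  have meas: "?E k x \<in> sets (?P k)" for k x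
    using measurable_crosses[of s k "\<lambda>_. U" b x] sets_U by (simp add: pred_def)
  define n where "n = Suc k"
  define t where "t = b * real n / x"
  have t: "0 < t" using Suc.prems \<open>0 < b\<close> by (simp add: t_def n_def)
  show ?case
  proof (cases "t \<le> 1")
    \<comment> \<open>The claimed bound is \<open>t\<close> itself, so for \<open>t > 1\<close>
      total mass 1 suffices.\<close>
    case False
    then show ?thesis
      using Pk'.emeasure_le_1[of "?E n x"] order_trans[of _ 1 "ennreal t"]
      by (simp add: t_def n_def)
  next
    case True
    let ?g = "\<lambda>u. indicator {0..t ^ n} u +
      ennreal (t * (1 - 1 / real n) * u powr (- 1 / real n)) * indicator {t ^ n..1} u"
    have ins: "{s<..n} = insert n {s<..k}" using \<open>s \<le> k\<close> by (auto simp: n_def)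
    have [measurable]: "?E n x \<in> sets (PiM (insert n {s<..k}) (\<lambda>_. U))"
      using meas[of n x] by (simp only: ins)
    \<comment> \<open>Pointwise bound on the conditional crossing probability given top coordinate
      \<open>u\<close>, weighted by the uniform density \<open>indicator {0..1} u\<close>.\<close>
    have inner: "(\<integral>\<^sup>+w. indicator (?E n x) (w(n := u)) \<partial>?P k) * indicator {0..1} u \<le> ?g u" for u
    proof (cases "0 \<le> u \<and> u \<le> t ^ n")
      case True
      have "(\<integral>\<^sup>+w. indicator (?E n x) (w(n := u)) \<partial>?P k) \<le> (\<integral>\<^sup>+w. 1 \<partial>?P k)"
        by (intro nn_integral_mono) (simp add: indicator_def)
      then have "(\<integral>\<^sup>+w. indicator (?E n x) (w(n := u)) \<partial>?P k) \<le> 1"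
        by (simp add: Pk.emeasure_space_1)
      moreover have "1 \<le> ?g u" using True by simp
      ultimately show ?thesis
        by (auto simp: indicator_def intro: order_trans split: if_splits)
    next
      case False
      show ?thesis
      proof (cases "u \<in> {0..1}")
        case u: True
        with False have tu: "t ^ n < u" by auto
        have "0 < t ^ n" using t by simp
        then have "0 < u" using tu by linarith
        define v where "v = exp (ln u / real n)"
        have v: "v = u powr (1 / real n)" using \<open>0 < u\<close> by (simp add: v_def powr_def)
        have "v ^ n = u"
          using \<open>0 < u\<close> by (simp add: v_def n_def exp_of_nat_mult[symmetric] del: of_nat_Suc power_Suc)
        then have "t < v"
          using tu power_less_imp_less_base[of t n v] by (simp add: v_def)
        \<comment> \<open>Since \<open>u > t ^ n\<close> means \<open>v > t\<close>, there is no
          crossing at \<open>n\<close> and only the second disjunct of \<open>crosses_Suc\<close>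
          remains.\<close>
        then have "b * real n < x * v"
          using Suc.prems by (simp add: t_def field_simps)
        then have "(\<integral>\<^sup>+w. indicator (?E n x) (w(n := u)) \<partial>?P k)
            \<le> (\<integral>\<^sup>+w. indicator (?E k (x * v)) w \<partial>?P k)"
          using crosses_Suc[OF \<open>s \<le> k\<close>, of b x _ u]
          by (intro nn_integral_mono) (auto simp: indicator_def v_def n_def)
        also have "\<dots> = emeasure (?P k) (?E k (x * v))"
          by (rule nn_integral_indicator[OF meas])
        also have "\<dots> \<le> ennreal (b * real k / (x * v))"
          using Suc.prems by (intro Suc.IH) (simp add: v_def)
        \<comment> \<open>As \<open>k = n - 1\<close>, the quotient \<open>b * k / x\<close> equals
          \<open>t * (1 - 1 / n)\<close>.\<close>
        also have "b * real k / (x * v) = t * (1 - 1 / real n) * u powr (- 1 / real n)"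
          using Suc.prems \<open>0 < u\<close>
          by (simp add: t_def v n_def powr_minus_divide field_simps del: of_nat_Suc) (simp add: algebra_simps)
        finally show ?thesis
          using u tu by (simp del: fun_upd_apply)
      qed (simp add: indicator_def)
    qed
    have "emeasure (?P n) (?E n x) = (\<integral>\<^sup>+w. indicator (?E n x) w \<partial>?P n)"
      by (rule nn_integral_indicator[OF meas, symmetric])
    also have "\<dots> = (\<integral>\<^sup>+u. (\<integral>\<^sup>+w. indicator (?E n x) (w(n := u)) \<partial>?P k) \<partial>U)"
      by (subst ins, rule P.product_nn_integral_insert_rev) (auto simp: n_def[symmetric], simp add: n_def)
    also have "\<dots> = (\<integral>\<^sup>+u. (\<integral>\<^sup>+w. indicator (?E n x) (w(n := u)) \<partial>?P k) * indicator {0..1} u \<partial>lborel)"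
    proof -
      have "(\<lambda>u. \<integral>\<^sup>+w. indicator (?E n x) (w(n := u)) \<partial>?P k) \<in> borel_measurable U"
        by measurable
      then have "(\<lambda>u. \<integral>\<^sup>+w. indicator (?E n x) (w(n := u)) \<partial>?P k) \<in> borel_measurable lborel"
        by (simp add: U_def)
      then show ?thesis
        unfolding U_def by (subst nn_integral_uniform_measure) (auto simp: divide_ennreal_def)
    qed
    also have "\<dots> \<le> (\<integral>\<^sup>+u. ?g u \<partial>lborel)"
      by (intro nn_integral_mono inner)
    also have "\<dots> = ennreal t"
      using t True by (intro nn_integral_crossing_bound) (auto simp: n_def)
    finally show ?thesis
      by (simp add: t_def n_def)
  qed
qed

text \<open>A maximum exceeds \<open>s\<close> iff some member does, and the default 0 for the empty
  set never exceeds \<open>s\<close>.\<close>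

lemma k_hat_S_gt_iff:
  "s < k_hat_S m \<alpha> p \<longleftrightarrow> crosses s (\<alpha> / real m) m 1 p"
proof -
  have q: "q_tilde m p k = exp (\<Sum>i=k..m. ln (p i) / real i)" for k
    by (simp add: q_tilde_def Z_tilde_def Y_tilde_def sum_negf)
  have "finite (strong_stop_set m \<alpha> p)"
    by (simp add: strong_stop_set_def)
  then have "s < k_hat_S m \<alpha> p \<longleftrightarrow> (\<exists>k\<in>strong_stop_set m \<alpha> p. s < k)"
    by (auto simp: k_hat_S_def Max_gr_iff)
  also have "\<dots> \<longleftrightarrow> crosses s (\<alpha> / real m) m 1 p"
    unfolding crosses_def strong_stop_set_def q Bex_def
    by (intro ex_cong1) auto
  finally show ?thesis .
qed

theorem theorem3:
  fixes M :: "'a measure"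
    and p :: "nat \<Rightarrow> 'a \<Rightarrow> real"
    and c :: "nat \<Rightarrow> real"
    and m s :: nat
    and \<alpha> :: real
  assumes "prob_space M"
    and "1 \<le> m" and "s \<le> m"
    and "0 < \<alpha>" and "\<alpha> < 1"
    and range: "\<And>i \<omega>. i \<in> {1..m} \<Longrightarrow> \<omega> \<in> space M \<Longrightarrow> p i \<omega> \<in> {0<..<1}"
    and nonnull: "\<And>i \<omega>. i \<in> {1..s} \<Longrightarrow> \<omega> \<in> space M \<Longrightarrow> p i \<omega> = c i"
    and null_indep: "prob_space.indep_vars M (\<lambda>_. borel) p {s+1..m}"
    and null_uniform: "\<And>i. i \<in> {s+1..m} \<Longrightarrow> distr M borel (p i) = uniform_measure lborel {0..1}"
  shows "measure M {\<omega> \<in> space M. k_hat_S m \<alpha> (\<lambda>i. p i \<omega>) > s} \<le> \<alpha>"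
proof (cases "s = m")
  case True
  then show ?thesis
    using \<open>0 < \<alpha>\<close> by (simp add: k_hat_S_gt_iff crosses_def)
next
  case False
  interpret prob_space M by fact
  let ?I = "{s<..m}"
  let ?U = "\<lambda>_::nat. uniform_measure lborel {0..1::real}"
  let ?X = "\<lambda>\<omega>. \<lambda>i\<in>?I. p i \<omega>"
  let ?E = "{w \<in> space (PiM ?I ?U). crosses s (\<alpha> / real m) m 1 w}"
  have I: "{s+1..m} = ?I" by auto
  have indep: "indep_vars (\<lambda>_. borel) p ?I" using null_indep by (simp only: I)
  then have rv: "\<And>i. i \<in> ?I \<Longrightarrow> p i \<in> borel_measurable M"
    by (simp add: indep_vars_def)
  \<comment> \<open>Independence turns the joint law into the product of the marginals; this
    characterization requires a nonempty index set, which \<open>s < m\<close> provides.\<close>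
  have "distr M (PiM ?I (\<lambda>_. borel)) ?X = PiM ?I (\<lambda>i. distr M borel (p i))"
    using indep indep_vars_iff_distr_eq_PiM'[of ?I p "\<lambda>_. borel"] rv False \<open>s \<le> m\<close> by auto
  also have "\<dots> = PiM ?I ?U"
    using null_uniform by (intro PiM_cong) (auto simp: I)
  finally have distr: "distr M (PiM ?I (\<lambda>_. borel)) ?X = PiM ?I ?U" .
  have X: "?X \<in> measurable M (PiM ?I (\<lambda>_. borel))"
    using rv by (intro measurable_restrict) auto
  have E: "?E \<in> sets (PiM ?I (\<lambda>_. borel))"
    using measurable_crosses[of s m ?U] by (simp add: pred_def sets_PiM_cong[of ?I ?I ?U "\<lambda>_. borel"])
  \<comment> \<open>Crossings read only coordinates above \<open>s\<close>, so restricting to the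
    null p-values leaves the event unchanged.\<close>
  have "crosses s b m x (?X \<omega>) \<longleftrightarrow> crosses s b m x (\<lambda>i. p i \<omega>)" for b x \<omega>
  proof -
    have "(\<Sum>i=j..m. ln (?X \<omega> i) / real i) = (\<Sum>i=j..m. ln (p i \<omega>) / real i)" if "s < j" for j
      using that by (intro sum.cong) auto
    then show ?thesis by (auto simp: crosses_def)
  qed
  then have "{\<omega> \<in> space M. k_hat_S m \<alpha> (\<lambda>i. p i \<omega>) > s} = ?X -` ?E \<inter> space M"
    by (auto simp: k_hat_S_gt_iff space_PiM)
  then have "emeasure M {\<omega> \<in> space M. k_hat_S m \<alpha> (\<lambda>i. p i \<omega>) > s} = emeasure (PiM ?I ?U) ?E"
    using emeasure_distr[OF X E] by (simp add: distr)
  also have "\<dots> \<le> ennreal (\<alpha> / real m * real m / 1)"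
    using assms by (intro prob_crosses_le) auto
  finally show ?thesis
    using \<open>1 \<le> m\<close> \<open>0 < \<alpha>\<close> by (simp add: emeasure_eq_measure)
qed

end
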